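(* Let $I\subset\mathbb R^2$ be open, $f:I\to\mathbb R$ smooth, and $v=v(t,s,x)$ smooth on $I\times\mathbb R$ with $$v_t=\tfrac12v_{xx},\qquad v_s=-\tfrac13v_{xxx},\qquad v(t,s,f(t,s))=0\ \text{ for all }(t,s)\in I .$$ Then, at $x=f(t,s)$, $$v^{(0)}=0,\qquad v^{(2)}+2f_tv^{(1)}=0,\qquad v^{(3)}-3f_sv^{(1)}=0 ,$$ or equivalently $v^{(0)}=0$, $v^{(2)}=-2f_tv^{(1)}$, $v^{(3)}=3f_sv^{(1)}$.
   Context: $v^{(k)}=\partial^kv/\partial x^k$, with $v^{(0)}=v$. *)

theory Defs
  imports "HOL-Analysis.Analysis"
begin

text \<open>
  Differentiability of class C^n on an open set S: the recursion asks for differentiability at the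
  points of S (not within S), so the notion is the usual one only for open S.
\<close>

fun C_n_on :: "nat \<Rightarrow> ('a::real_normed_vector \<Rightarrow> 'b::real_normed_vector) \<Rightarrow> 'a set \<Rightarrow> bool" where
  "C_n_on 0 f S \<longleftrightarrow> continuous_on S f"
| "C_n_on (Suc n) f S \<longleftrightarrow>
     (\<forall>x\<in>S. f differentiable (at x)) \<and>
     (\<forall>h. C_n_on n (\<lambda>x. frechet_derivative f (at x) h) S)"

definition smooth_on :: "('a::real_normed_vector \<Rightarrow> 'b::real_normed_vector) \<Rightarrow> 'a set \<Rightarrow> bool" where
  "smooth_on f S \<longleftrightarrow> (\<forall>n. C_n_on n f S)"

definition x_deriv ::
    "nat \<Rightarrow> (real \<Rightarrow> real \<Rightarrow> real \<Rightarrow> real) \<Rightarrow> real \<Rightarrow> real \<Rightarrow> real \<Rightarrow> real" where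
  "x_deriv k v t s x = (deriv ^^ k) (\<lambda>y. v t s y) x"

end

theory Submission
  imports Defs
begin

text \<open>The function \<open>v\<close> vanishes on the graph of \<open>f\<close>, so
  differentiating \<open>v t s (f t s) = 0\<close> in \<open>t\<close> and in \<open>s\<close> gives
  v_t + f_t v_x = 0 and v_s + f_s v_x = 0 at x = f(t,s). The two evolution equations turn v_t and
  v_s into multiples of v_xx and v_xxx, and clearing the factors 1/2 and -1/3 gives the claim. The
  chain rule is carried by \<open>frechet_derivative_zero_on_graph\<close>, in terms of total
  derivatives; \<open>deriv_along_line\<close> translates these into the one-variable
  \<open>deriv\<close> of the hypotheses.\<close>

lemma smooth_on_imp_differentiable:
  assumes "smooth_on F S" "p \<in> S"
  shows "F differentiable (at p)"
proof -
  have "C_n_on (Suc 0) F S"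
    using assms(1) unfolding smooth_on_def by blast
  then show ?thesis
    using assms(2) by simp
qed

text \<open>Links partial and total derivatives. The line passes through \<open>p\<close> at
  \<open>r = c\<close>; when \<open>h\<close> is a coordinate vector and \<open>c\<close> the
  matching coordinate of \<open>p\<close>, it just replaces that coordinate by \<open>r\<close>, so
  the left side is a partial derivative.\<close>

lemma deriv_along_line:
  fixes F :: "'a::real_normed_vector \<Rightarrow> real"
  assumes "F differentiable (at p)"
  shows "deriv (\<lambda>r. F (p + (r - c) *\<^sub>R h)) c = frechet_derivative F (at p) h"
proof -
  let ?D = "frechet_derivative F (at p)"
  have D: "(F has_derivative ?D) (at p)"
    using assms by (simp add: frechet_derivative_works)
  have line: "((\<lambda>r. p + (r - c) *\<^sub>R h) has_derivative (\<lambda>r. r *\<^sub>R h)) (at c)"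
    by (auto intro!: derivative_eq_intros)
  have "((\<lambda>r. F (p + (r - c) *\<^sub>R h)) has_derivative (\<lambda>r. ?D (r *\<^sub>R h))) (at c)"
    by (rule has_derivative_compose[OF line]) (use D in simp)
  moreover have "?D (r *\<^sub>R h) = ?D h * r" for r
    using linear_cmul[OF has_derivative_linear[OF D]] by simp
  ultimately have "((\<lambda>r. F (p + (r - c) *\<^sub>R h)) has_field_derivative ?D h) (at c)"
    by (simp add: has_field_derivative_def)
  then show ?thesis
    by (rule DERIV_imp_deriv)
qed

text \<open>The chain rule for \<open>V (q, g q)\<close>: this composite is zero near
  \<open>p\<close>, so its derivative \<open>?DV (h, ?Dg h)\<close> is zero, and linearity splits it
  into a base part and a fibre part.\<close>

lemma frechet_derivative_zero_on_graph:
  fixes V :: "'a::real_normed_vector \<times> real \<Rightarrow> real"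
  assumes "open S" "p \<in> S"
    and V: "V differentiable (at (p, g p))"
    and g: "g differentiable (at p)"
    and zero: "\<And>q. q \<in> S \<Longrightarrow> V (q, g q) = 0"
  shows "frechet_derivative V (at (p, g p)) (h, 0)
    + frechet_derivative g (at p) h * frechet_derivative V (at (p, g p)) (0, 1) = 0"
proof -
  let ?DV = "frechet_derivative V (at (p, g p))" and ?Dg = "frechet_derivative g (at p)"
  have DV: "(V has_derivative ?DV) (at (p, g p))"
    using V by (simp add: frechet_derivative_works)
  have "(g has_derivative ?Dg) (at p)"
    using g by (simp add: frechet_derivative_works)
  then have "((\<lambda>q. (q, g q)) has_derivative (\<lambda>h. (h, ?Dg h))) (at p)"
    by (intro has_derivative_Pair has_derivative_ident)
  then have "((\<lambda>q. V (q, g q)) has_derivative (\<lambda>h. ?DV (h, ?Dg h))) (at p)"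
    by (rule has_derivative_compose) (rule DV)
  \<comment> \<open>Openness of \<open>S\<close> makes the composite agree with 0 on a neighbourhood
    of \<open>p\<close>; uniqueness of the derivative then applies.\<close>
  then have "((\<lambda>q. 0) has_derivative (\<lambda>h. ?DV (h, ?Dg h))) (at p)"
    by (rule has_derivative_transform_within_open) (use assms in auto)
  then have "?DV (h, ?Dg h) = 0"
    by (metis has_derivative_const has_derivative_unique)
  moreover have "(h, ?Dg h) = (h, 0) + ?Dg h *\<^sub>R (0, 1)"
    by simp
  then have "?DV (h, ?Dg h) = ?DV (h, 0) + ?Dg h * ?DV (0, 1)"
    using linear_add[OF has_derivative_linear[OF DV]] linear_cmul[OF has_derivative_linear[OF DV]]
    by (metis real_scaleR_def)
  ultimately show ?thesis
    by simp
qed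

theorem proposition5p2:
  fixes I :: "(real \<times> real) set"
    and f :: "real \<Rightarrow> real \<Rightarrow> real"
    and v :: "real \<Rightarrow> real \<Rightarrow> real \<Rightarrow> real"
  assumes "open I"
    and "smooth_on (\<lambda>(t, s). f t s) I"
    and "smooth_on (\<lambda>((t, s), x). v t s x) (I \<times> UNIV)"
    and "\<And>t s x. (t, s) \<in> I \<Longrightarrow> deriv (\<lambda>t'. v t' s x) t = (1/2) * x_deriv 2 v t s x"
    and "\<And>t s x. (t, s) \<in> I \<Longrightarrow> deriv (\<lambda>s'. v t s' x) s = - (1/3) * x_deriv 3 v t s x"
    and "\<And>t s. (t, s) \<in> I \<Longrightarrow> v t s (f t s) = 0"
  shows "\<forall>(t, s) \<in> I.
    (let x = f t s; f_t = deriv (\<lambda>t'. f t' s) t; f_s = deriv (\<lambda>s'. f t s') s in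
       (x_deriv 0 v t s x = 0
        \<and> x_deriv 2 v t s x + 2 * f_t * x_deriv 1 v t s x = 0
        \<and> x_deriv 3 v t s x - 3 * f_s * x_deriv 1 v t s x = 0)
     \<and> (x_deriv 0 v t s x = 0
        \<and> x_deriv 2 v t s x = - 2 * f_t * x_deriv 1 v t s x
        \<and> x_deriv 3 v t s x = 3 * f_s * x_deriv 1 v t s x))"
proof (intro ballI, clarify)
  fix t s
  assume ts: "(t, s) \<in> I"
  \<comment> \<open>Uncurried forms, with \<open>(t, s)\<close> paired first so that points of the
    graph read \<open>(q, g q)\<close>.\<close>
  define g :: "real \<times> real \<Rightarrow> real" where "g = (\<lambda>(t, s). f t s)"
  define V :: "(real \<times> real) \<times> real \<Rightarrow> real" where "V = (\<lambda>((t, s), x). v t s x)"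
  define x where "x = f t s"
  let ?p = "((t, s), x)"
  let ?DV = "frechet_derivative V (at ?p)" and ?Dg = "frechet_derivative g (at (t, s))"
  have dg: "g differentiable (at (t, s))"
    using assms(2) ts unfolding g_def by (rule smooth_on_imp_differentiable)
  have dV: "V differentiable (at ?p)"
    by (rule smooth_on_imp_differentiable[OF assms(3)[folded V_def]]) (use ts in simp)
  have ft: "deriv (\<lambda>t'. f t' s) t = ?Dg (1, 0)"
    using deriv_along_line[OF dg, of t "(1, 0)"] by (simp add: g_def)
  have fs: "deriv (\<lambda>s'. f t s') s = ?Dg (0, 1)"
    using deriv_along_line[OF dg, of s "(0, 1)"] by (simp add: g_def)
  have vt: "(1/2) * x_deriv 2 v t s x = ?DV ((1, 0), 0)"
    using deriv_along_line[OF dV, of t "((1, 0), 0)"] assms(4)[OF ts, of x] by (simp add: V_def)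
  have vs: "- (1/3) * x_deriv 3 v t s x = ?DV ((0, 1), 0)"
    using deriv_along_line[OF dV, of s "((0, 1), 0)"] assms(5)[OF ts, of x] by (simp add: V_def)
  \<comment> \<open>Here the first 0 is the zero of the plane; \<open>zero_prod_def\<close> splits
    it into \<open>(0, 0)\<close>.\<close>
  have vx: "x_deriv 1 v t s x = ?DV (0, 1)"
    using deriv_along_line[OF dV, of x "(0, 1)"] by (simp add: V_def x_deriv_def zero_prod_def)
  have gx: "g (t, s) = x"
    by (simp add: g_def x_def)
  have chain: "?DV (h, 0) + ?Dg h * ?DV (0, 1) = 0" for h
    using frechet_derivative_zero_on_graph[OF \<open>open I\<close> ts, of V g h] dV dg assms(6)
    unfolding gx by (force simp: V_def g_def)
  have "x_deriv 0 v t s x = 0"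
    using assms(6)[OF ts] by (simp add: x_deriv_def x_def)
  \<comment> \<open>In the direction of \<open>t\<close> the chain rule reads v_xx/2 + f_t v_x = 0;
    in the direction of \<open>s\<close> below, -v_xxx/3 + f_s v_x = 0.\<close>
  moreover have "x_deriv 2 v t s x = - 2 * ?Dg (1, 0) * x_deriv 1 v t s x"
    using chain[of "(1, 0)"] vt vx by simp
  moreover have "x_deriv 3 v t s x = 3 * ?Dg (0, 1) * x_deriv 1 v t s x"
    using chain[of "(0, 1)"] vs vx by simp
  ultimately show "let x = f t s; f_t = deriv (\<lambda>t'. f t' s) t; f_s = deriv (\<lambda>s'. f t s') s in
       (x_deriv 0 v t s x = 0
        \<and> x_deriv 2 v t s x + 2 * f_t * x_deriv 1 v t s x = 0
        \<and> x_deriv 3 v t s x - 3 * f_s * x_deriv 1 v t s x = 0)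
     \<and> (x_deriv 0 v t s x = 0
        \<and> x_deriv 2 v t s x = - 2 * f_t * x_deriv 1 v t s x
        \<and> x_deriv 3 v t s x = 3 * f_s * x_deriv 1 v t s x)"
    unfolding Let_def ft fs x_def[symmetric] by simp
qed

end
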